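(* Let $(\mathfrak P,\mathfrak T,\mathfrak e)$ be a state system (as defined in the context) with poset of states $(\mathfrak S,\sqsubseteq)$. For every $\sigma\in\mathfrak S$: $\sigma$ is a pure state if and only if either (Type 1) $\sigma$ is a maximal element of $\mathfrak S$, or (Type 2) the set $\{\tau\in\mathfrak S\mid\sigma\sqsubseteq\tau,\ \tau\neq\sigma\}$ admits a minimum element.
   Context: Let $\mathfrak B=\{\bot,\mathbf Y,\mathbf N\}$ with partial order $u\le v$ iff $u=\bot$ or $u=v$, and involution $\overline{\bot}=\bot$, $\overline{\mathbf Y}=\mathbf N$, $\overline{\mathbf N}=\mathbf Y$. The data are: sets $\mathfrak P$ (preparations) and $\mathfrak T$ (yes/no tests), a map $\mathfrak e:\mathfrak P\times\mathfrak T\to\mathfrak B$, and a map $\mathfrak t\mapsto\overline{\mathfrak t}$ on $\mathfrak T$ with $\mathfrak e(\mathfrak p,\overline{\mathfrak t})=\overline{\mathfrak e(\mathfrak p,\mathfrak t)}$ for all $\mathfrak p,\mathfrak t$. Put $\mathfrak p_1\sim\mathfrak p_2$ iff $\mathfrak e(\mathfrak p_1,\mathfrak t)=\mathfrak e(\mathfrak p_2,\mathfrak t)$ for all $\mathfrak t$; $\mathfrak S=\mathfrak P/\sim$ is the set of states, $\lceil\mathfrak p\rceil$ is the class of $\mathfrak p$, $\widetilde{\mathfrak e}_{\mathfrak t}(\lceil\mathfrak p\rceil)=\mathfrak e(\mathfrak p,\mathfrak t)$, and $\sigma_1\sqsubseteq\sigma_2$ iff $\widetilde{\mathfrak e}_{\mathfrak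 t}(\sigma_1)\le\widetilde{\mathfrak e}_{\mathfrak t}(\sigma_2)$ for all $\mathfrak t\in\mathfrak T$ (a partial order on $\mathfrak S$). $\sqcap,\inf$ and $\sqcup,\bigsqcup$ are infima and (when they exist) suprema in $\mathfrak S$; $\sigma\sqsubset\tau$ means $\sigma\sqsubseteq\tau$, $\sigma\ne\tau$; $\sigma\lessdot\tau$ means that $\tau$ covers $\sigma$. A state system is such data satisfying: (A1) for every nonempty $P\subseteq\mathfrak P$ there is a unique element of $\mathfrak P$, denoted $\inf P$, with $\mathfrak e(\inf P,\mathfrak t)=\bigwedge_{\mathfrak p\in P}\mathfrak e(\mathfrak p,\mathfrak t)$ for all $\mathfrak t$ (so every nonempty subset of $\mathfrak S$ has an infimum); (A2) there is a unique $\mathfrak p_\bot\in\mathfrak P$ with $\mathfrak e(\mathfrak p_\bot,\mathfrak t)=\bot$ for all $\mathfrak t$; (A3) every nonempty chain in $\mathfrak S$ has a supremum in $\mathfrak S$; (A4) for every $\mathfrak t\in\mathfrak T$ and every nonempty chain $\mathfrak C\subseteq\mathfrak S$, if $\widetilde{\mathfrak e}_{\mathfrak t}(\bigsqcup\mathfrak C)=\mathbf Y$ then $\widetilde{\mathfrak e}_{\mathfrak t}(\sigma)=\mathbf Y$ for some $\sigma\in\mathfrak C$; (A5) if $\sigma\sqsubset\sigma'$ then there is $\sigma''$ with $\sigma\lessdot\sigma''\sqsubseteq\sigma'$; (A6) (a) if $\sigma_1\sqsubseteq\sigma_2\sqsubseteq\sigma_2'$ there is $\sigma_1'$ with $\sigma_1=\sigma_1'\sqcap\sigma_2$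 and $\sigma_2'=\sigma_1'\sqcup\sigma_2$; (b) if $\sigma_1'\sqsubseteq\sigma_2'$, $\sigma_2\lessdot\sigma_2'$ and $\sigma_1'\not\sqsubseteq\sigma_2$, then $(\sigma_1'\sqcap\sigma_2)\lessdot\sigma_1'$; (c) if $\sigma_1\sqsubseteq\sigma_1'\sqsubseteq\sigma_2'$, $\sigma_1\lessdot\sigma_2\sqsubseteq\sigma_2'$ and $\sigma_2\not\sqsubseteq\sigma_1'$, then $\sigma_1'\lessdot(\sigma_1'\sqcup\sigma_2)$. A state $\sigma$ is pure if for every nonempty $S\subseteq\mathfrak S$, $\sigma=\inf S$ implies $\sigma\in S$. *)

theory Defs
  imports "HOL-Algebra.Lattice"
begin

datatype bval = Bot | Yes | No

primrec bval_neg :: "bval \<Rightarrow> bval" where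
  "bval_neg Bot = Bot"
| "bval_neg Yes = No"
| "bval_neg No = Yes"

definition bval_order :: "bval gorder" where
  "bval_order = \<lparr>carrier = UNIV, eq = (=), le = (\<lambda>u v. u = Bot \<or> u = v)\<rparr>"

definition prep_equiv :: "'p set \<Rightarrow> 't set \<Rightarrow> ('p \<Rightarrow> 't \<Rightarrow> bval) \<Rightarrow> ('p \<times> 'p) set" where
  "prep_equiv P T e = {(p, q). p \<in> P \<and> q \<in> P \<and> (\<forall>t\<in>T. e p t = e q t)}"

text \<open>States are equivalence classes, hence sets of preparations. All members of a state have the
  same value at a test in \<open>T\<close>, so the image below is then a singleton
  (see \<open>state_eval_class\<close>).\<close>

definition state_eval :: "('p \<Rightarrow> 't \<Rightarrow> bval) \<Rightarrow> 't \<Rightarrow> 'p set \<Rightarrow> bval" where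
  "state_eval e t \<sigma> = the_elem ((\<lambda>p. e p t) ` \<sigma>)"

definition state_order :: "'p set \<Rightarrow> 't set \<Rightarrow> ('p \<Rightarrow> 't \<Rightarrow> bval) \<Rightarrow> 'p set gorder" where
  "state_order P T e =
    \<lparr>carrier = P // prep_equiv P T e,
     eq = (=),
     le = (\<lambda>\<sigma> \<tau>. \<forall>t\<in>T. state_eval e t \<sigma> \<sqsubseteq>\<^bsub>bval_order\<^esub> state_eval e t \<tau>)\<rparr>"

definition covered_by :: "('a, 'b) gorder_scheme \<Rightarrow> 'a \<Rightarrow> 'a \<Rightarrow> bool" where
  "covered_by L x y \<longleftrightarrow> x \<in> carrier L \<and> y \<in> carrier L \<and> x \<sqsubset>\<^bsub>L\<^esub> y \<and>
    \<not> (\<exists>z\<in>carrier L. x \<sqsubset>\<^bsub>L\<^esub> z \<and> z \<sqsubset>\<^bsub>L\<^esub> y)"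

definition maximal_elem :: "('a, 'b) gorder_scheme \<Rightarrow> 'a \<Rightarrow> bool" where
  "maximal_elem L x \<longleftrightarrow> x \<in> carrier L \<and> \<not> (\<exists>y\<in>carrier L. x \<sqsubset>\<^bsub>L\<^esub> y)"

definition pure_state :: "('a, 'b) gorder_scheme \<Rightarrow> 'a \<Rightarrow> bool" where
  "pure_state L \<sigma> \<longleftrightarrow> \<sigma> \<in> carrier L \<and>
    (\<forall>A. A \<subseteq> carrier L \<and> A \<noteq> {} \<and> is_glb L \<sigma> A \<longrightarrow> \<sigma> \<in> A)"

locale preparation_test_data =
  fixes P :: "'p set" and T :: "'t set" and e :: "'p \<Rightarrow> 't \<Rightarrow> bval" and neg :: "'t \<Rightarrow> 't"
  assumes neg_closed: "t \<in> T \<Longrightarrow> neg t \<in> T"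
    and eval_neg: "\<lbrakk>p \<in> P; t \<in> T\<rbrakk> \<Longrightarrow> e p (neg t) = bval_neg (e p t)"
begin

abbreviation S where "S \<equiv> state_order P T e"

end

text \<open>Infima and suprema are stated through \<^term>\<open>is_glb\<close> and \<^term>\<open>is_lub\<close> rather than the choice
  operators of \<^theory>\<open>HOL-Algebra.Lattice\<close>, so that an equation \<open>x = y \<squnion> z\<close> includes the existence
  of the supremum.\<close>

locale state_system = preparation_test_data P T e neg
  for P :: "'p set" and T :: "'t set" and e :: "'p \<Rightarrow> 't \<Rightarrow> bval" and neg :: "'t \<Rightarrow> 't" +
  assumes A1: "\<lbrakk>Q \<subseteq> P; Q \<noteq> {}\<rbrakk> \<Longrightarrow>
      \<exists>!i. i \<in> P \<and> (\<forall>t\<in>T. is_glb bval_order (e i t) ((\<lambda>p. e p t) ` Q))"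
    and A2: "\<exists>!p. p \<in> P \<and> (\<forall>t\<in>T. e p t = Bot)"
    and A3: "\<lbrakk>C \<subseteq> carrier S; C \<noteq> {}; Complete_Partial_Order.chain (\<sqsubseteq>\<^bsub>S\<^esub>) C\<rbrakk> \<Longrightarrow>
      \<exists>s. is_lub S s C"
    and A4: "\<lbrakk>t \<in> T; C \<subseteq> carrier S; C \<noteq> {}; Complete_Partial_Order.chain (\<sqsubseteq>\<^bsub>S\<^esub>) C;
      is_lub S s C; state_eval e t s = Yes\<rbrakk> \<Longrightarrow> \<exists>\<sigma>\<in>C. state_eval e t \<sigma> = Yes"
    and A5: "\<lbrakk>\<sigma> \<in> carrier S; \<sigma>' \<in> carrier S; \<sigma> \<sqsubset>\<^bsub>S\<^esub> \<sigma>'\<rbrakk> \<Longrightarrow>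
      \<exists>\<sigma>''\<in>carrier S. covered_by S \<sigma> \<sigma>'' \<and> \<sigma>'' \<sqsubseteq>\<^bsub>S\<^esub> \<sigma>'"
    and A6a: "\<lbrakk>\<sigma>1 \<in> carrier S; \<sigma>2 \<in> carrier S; \<sigma>2' \<in> carrier S; \<sigma>1 \<sqsubseteq>\<^bsub>S\<^esub> \<sigma>2; \<sigma>2 \<sqsubseteq>\<^bsub>S\<^esub> \<sigma>2'\<rbrakk> \<Longrightarrow>
      \<exists>\<sigma>1'\<in>carrier S. is_glb S \<sigma>1 {\<sigma>1', \<sigma>2} \<and> is_lub S \<sigma>2' {\<sigma>1', \<sigma>2}"
    and A6b: "\<lbrakk>\<sigma>1' \<in> carrier S; \<sigma>2 \<in> carrier S; \<sigma>2' \<in> carrier S;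
      \<sigma>1' \<sqsubseteq>\<^bsub>S\<^esub> \<sigma>2'; covered_by S \<sigma>2 \<sigma>2'; \<not> \<sigma>1' \<sqsubseteq>\<^bsub>S\<^esub> \<sigma>2\<rbrakk> \<Longrightarrow>
      \<exists>m. is_glb S m {\<sigma>1', \<sigma>2} \<and> covered_by S m \<sigma>1'"
    and A6c: "\<lbrakk>\<sigma>1 \<in> carrier S; \<sigma>1' \<in> carrier S; \<sigma>2 \<in> carrier S; \<sigma>2' \<in> carrier S;
      \<sigma>1 \<sqsubseteq>\<^bsub>S\<^esub> \<sigma>1'; \<sigma>1' \<sqsubseteq>\<^bsub>S\<^esub> \<sigma>2'; covered_by S \<sigma>1 \<sigma>2; \<sigma>2 \<sqsubseteq>\<^bsub>S\<^esub> \<sigma>2'; \<not> \<sigma>2 \<sqsubseteq>\<^bsub>S\<^esub> \<sigma>1'\<rbrakk> \<Longrightarrow>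
      \<exists>j. is_lub S j {\<sigma>1', \<sigma>2} \<and> covered_by S \<sigma>1' j"

lemma equiv_prep_equiv: "equiv P (prep_equiv P T e)"
  by (rule equivI) (auto simp: prep_equiv_def refl_on_def sym_on_def trans_on_def)

lemma state_eval_class:
  assumes "p \<in> P" "t \<in> T"
  shows "state_eval e t (prep_equiv P T e `` {p}) = e p t"
  unfolding state_eval_def using assms
  by (intro the_elem_image_unique) (auto simp: prep_equiv_def)

lemma partial_order_state_order: "partial_order (state_order P T e)"
proof
  show "(.=\<^bsub>state_order P T e\<^esub>) = (=)"
    by (simp add: state_order_def)
next
  fix x y
  assume le: "x \<sqsubseteq>\<^bsub>state_order P T e\<^esub> y" "y \<sqsubseteq>\<^bsub>state_order P T e\<^esub> x"
    and "x \<in> carrier (state_order P T e)" "y \<in> carrier (state_order P T e)"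
  then obtain p q where pq: "p \<in> P" "q \<in> P"
    "x = prep_equiv P T e `` {p}" "y = prep_equiv P T e `` {q}"
    by (auto simp: state_order_def elim!: quotientE)
  have "\<forall>t\<in>T. state_eval e t x = state_eval e t y"
    using le unfolding state_order_def bval_order_def gorder.simps by metis
  then have "(p, q) \<in> prep_equiv P T e"
    using pq by (simp add: state_eval_class) (simp add: prep_equiv_def)
  then show "x .=\<^bsub>state_order P T e\<^esub> y"
    using pq equiv_class_eq[OF equiv_prep_equiv] by (simp add: state_order_def)
qed (auto simp: state_order_def bval_order_def; metis)+

end

theory Submission
  imports Defs
begin

text \<open>Let \<open>U\<close> be the set of elements strictly above \<open>x\<close>. If
  \<open>x\<close> is not maximal, \<open>U\<close> is nonempty and has an infimum \<open>m\<close>,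
  and \<open>x\<close>, being a lower bound of \<open>U\<close>, lies below \<open>m\<close>. Purity
  excludes \<open>m = x\<close>, because \<open>x\<close> is not in \<open>U\<close>; so
  \<open>m\<close> lies in \<open>U\<close> and is its minimum. Conversely, if \<open>x\<close> is
  the infimum of a nonempty \<open>A\<close> not containing \<open>x\<close>, then \<open>A\<close>
  is contained in \<open>U\<close>: so \<open>x\<close> is not maximal, and a minimum of
  \<open>U\<close> would be a lower bound of \<open>A\<close>, hence below \<open>x\<close>, which
  is absurd. The argument lives in any partial order with infima of nonempty subsets;
  \<open>state_infimum_exists\<close> provides these for states.\<close>

lemma (in partial_order) pure_state_iff:
  assumes glb: "\<And>A. \<lbrakk>A \<subseteq> carrier L; A \<noteq> {}\<rbrakk> \<Longrightarrow> \<exists>i. is_glb L i A"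
    and x: "x \<in> carrier L"
  shows "pure_state L x \<longleftrightarrow>
    maximal_elem L x \<or> (\<exists>m. least L m {y \<in> carrier L. x \<sqsubseteq> y \<and> y \<noteq> x})"
    (is "_ \<longleftrightarrow> _ \<or> (\<exists>m. least L m ?U)")
proof
  assume pure: "pure_state L x"
  show "maximal_elem L x \<or> (\<exists>m. least L m ?U)"
  proof (cases "?U = {}")
    case True
    then show ?thesis
      using x by (auto simp: maximal_elem_def lless_eq)
  next
    case False
    then obtain m where m: "is_glb L m ?U"
      using glb[of ?U] by blast
    have "x \<in> Lower L ?U"
      using x by (auto simp: Lower_def)
    with m have "x \<sqsubseteq> m"
      by (rule greatest_le)
    moreover have "m \<in> carrier L" and "\<And>u. u \<in> ?U \<Longrightarrow> m \<sqsubseteq> u"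
      using m by (auto simp: greatest_def Lower_def)
    \<comment> \<open>Purity is applied to the set \<open>?U\<close> itself, which omits
      \<open>x\<close> by construction.\<close>
    moreover have "m \<noteq> x"
    proof
      assume "m = x"
      with m have "is_glb L x ?U" by simp
      moreover have "?U \<subseteq> carrier L" by blast
      ultimately have "x \<in> ?U"
        using pure False unfolding pure_state_def by blast
      then show False by simp
    qed
    ultimately have "least L m ?U"
      unfolding least_def by blast
    then show ?thesis by blast
  qed
next
  assume type: "maximal_elem L x \<or> (\<exists>m. least L m ?U)"
  have "x \<in> A" if A: "A \<subseteq> carrier L" "A \<noteq> {}" and g: "is_glb L x A" for A
  proof (rule ccontr)
    assume "x \<notin> A"
    moreover have "x \<sqsubseteq> a" if "a \<in> A" for a
      using g A that by (auto simp: greatest_def Lower_def)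
    ultimately have sub: "A \<subseteq> ?U"
      using A by blast
    from type show False
    proof
      assume "maximal_elem L x"
      then show False
        using sub A by (auto simp: maximal_elem_def lless_eq)
    next
      assume "\<exists>m. least L m ?U"
      then obtain m where m: "least L m ?U" ..
      then have "m \<in> Lower L A"
        using sub by (auto simp: least_def Lower_def)
      then have "m \<sqsubseteq> x"
        using g by (auto simp: greatest_def)
      then show False
        using m x le_antisym by (auto simp: least_def)
    qed
  qed
  then show "pure_state L x"
    using x by (simp add: pure_state_def)
qed

text \<open>States are ordered test by test, so infima can be computed test by test: the class of
  the preparation that \<open>A1\<close> assigns to the representatives of \<open>A\<close> is the
  infimum.\<close>

lemma (in state_system) state_infimum_exists:
  assumes A: "A \<subseteq> carrier S" "A \<noteq> {}"
  shows "\<exists>i. is_glb S i A"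
proof -
  let ?c = "\<lambda>p. prep_equiv P T e `` {p}"
  have rep: "\<exists>p\<in>P. a = ?c p" if "a \<in> A" for a
  proof -
    from that A have "a \<in> P // prep_equiv P T e"
      by (auto simp: state_order_def)
    then show ?thesis
      by (blast elim: quotientE)
  qed
  \<comment> \<open>Taking every representative of every class in \<open>A\<close> avoids choosing
    one per class.\<close>
  define Q where "Q = {p \<in> P. ?c p \<in> A}"
  have "Q \<subseteq> P" "Q \<noteq> {}"
    using A(2) rep unfolding Q_def by blast+
  then obtain i where i: "i \<in> P"
    and inf: "\<And>t. t \<in> T \<Longrightarrow> is_glb bval_order (e i t) ((\<lambda>p. e p t) ` Q)"
    using A1 by metis
  have eval_image: "(\<lambda>p. e p t) ` Q = state_eval e t ` A" if "t \<in> T" for t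
  proof -
    have "A = ?c ` Q"
      using rep unfolding Q_def by blast
    then have "state_eval e t ` A = (\<lambda>p. state_eval e t (?c p)) ` Q"
      by (metis image_image)
    also have "\<dots> = (\<lambda>p. e p t) ` Q"
      using that by (intro image_cong) (auto simp: Q_def state_eval_class)
    finally show ?thesis ..
  qed
  have "is_glb S (?c i) A"
  proof (rule greatest_LowerI)
    show "?c i \<in> carrier S"
      using i by (simp add: state_order_def quotientI)
  next
    fix a assume "a \<in> A"
    then show "?c i \<sqsubseteq>\<^bsub>S\<^esub> a"
      using inf eval_image i
      by (auto simp: state_order_def state_eval_class greatest_def Lower_def bval_order_def)
  next
    \<comment> \<open>A lower bound in \<open>S\<close> gives, at each test, a lower bound of the
      values, and \<open>e i t\<close> is the greatest of those.\<close>
    fix s assume "s \<in> Lower S A"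
    then have "state_eval e t s \<in> Lower bval_order (state_eval e t ` A)" if "t \<in> T" for t
      using A that by (force simp: state_order_def Lower_def bval_order_def)
    then have "state_eval e t s \<sqsubseteq>\<^bsub>bval_order\<^esub> e i t" if "t \<in> T" for t
      using inf[OF that] eval_image[OF that] that by (auto simp: greatest_def)
    then show "s \<sqsubseteq>\<^bsub>S\<^esub> ?c i"
      using i by (simp add: state_order_def state_eval_class)
  qed (use A in auto)
  then show ?thesis ..
qed

theorem theorem3:
  fixes P :: "'p set" and T :: "'t set" and e :: "'p \<Rightarrow> 't \<Rightarrow> bval" and neg :: "'t \<Rightarrow> 't"
    and \<sigma> :: "'p set"
  assumes "state_system P T e neg"
    and "\<sigma> \<in> carrier (state_order P T e)"
  shows "pure_state (state_order P T e) \<sigma> \<longleftrightarrow>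
    maximal_elem (state_order P T e) \<sigma> \<or>
    (\<exists>m. least (state_order P T e) m
      {\<tau> \<in> carrier (state_order P T e). \<sigma> \<sqsubseteq>\<^bsub>state_order P T e\<^esub> \<tau> \<and> \<tau> \<noteq> \<sigma>})"
  using assms
  by (intro partial_order.pure_state_iff partial_order_state_order
      state_system.state_infimum_exists)

end
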